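(* Let $b_{\mathrm g}, b_{\mathrm{msc}}, C_{\mathrm{dc}}, J_{\mathrm g}, J_{\mathrm{wt}}, T_{\mathrm g}, k_{\mathrm g}, \omega_0, \omega_r^{\mathrm{del}} \in \mathbb{R}_{>0}$, let $K_\theta^{\mathrm{gsc}}, K_\theta^{\mathrm{msc}}, K_d^{\mathrm{gsc}}, K_d^{\mathrm{msc}} \in \mathbb{R}_{>0}$, and let $K_{\omega_r}, K_\beta \in \mathbb{R}$ and $K_p \in \mathbb{R}_{\ge 0}$. Consider the linear time-invariant system with state $(\varrho_\delta, \omega_\delta, v_{\delta,\mathrm{dc}}, P_{\delta,\mathrm g}) \in \mathbb{R}^2\times\mathbb{R}^2\times\mathbb{R}\times\mathbb{R}$ given by $$ T \frac{\mathrm d}{\mathrm dt}\begin{bmatrix}\varrho_\delta\\ \omega_\delta\\ v_{\delta,\mathrm{dc}}\\ P_{\delta,\mathrm g}\end{bmatrix} = \begin{bmatrix} -K_d' \,\mathbf 1_{2\times 2}\, \mathcal B & -I_2 & K_\theta \mathbf 1_2 & \mathbf 0_2\\ \mathcal B & -K_{\mathrm{wt}} & \mathbf 0_2 & \mathbf e\\ -\mathbf 1_2^\top \mathcal B & \mathbf 0_2^\top & 0 & 0\\ \mathbf 0_2^\top & -k_{\mathrm g}\mathbf e^\top & 0 & -1 \end{bmatrix} \begin{bmatrix}\varrho_\delta\\ \omega_\delta\\ v_{\delta,\mathrm{dc}}\\ P_{\delta,\mathrm g}\end{bmatrix}, $$ where $\mathbf e=(1,0)^\top$, $\mathbf 1_2=(1,1)^\top$,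 $\mathbf 0_2=(0,0)^\top$, $\mathbf 1_{2\times2}=\mathbf 1_2\mathbf 1_2^\top$, $I_2$ is the $2\times 2$ identity matrix, $\mathcal B=\mathrm{diag}(b_{\mathrm g},b_{\mathrm{msc}})$, $K_d'=\mathrm{diag}(K_d^{\mathrm{gsc}}/C_{\mathrm{dc}},\,K_d^{\mathrm{msc}}/C_{\mathrm{dc}})$, $K_\theta=\mathrm{diag}(K_\theta^{\mathrm{gsc}},K_\theta^{\mathrm{msc}})$, $K_{\mathrm{wt}}=\mathrm{diag}(0,\,K_{\omega_r}+K_\beta K_p)$, $J=\mathrm{diag}(J_{\mathrm g}\omega_0,\,J_{\mathrm{wt}}\omega_r^{\mathrm{del}})$, and $T=\mathrm{diag}(I_2,J,C_{\mathrm{dc}},T_{\mathrm g})$ (block diagonal, $6\times 6$). Assume that $K_{\omega_r}+K_\beta K_p\ge 0$ and $K_d^{\mathrm{gsc}}/K_\theta^{\mathrm{gsc}}=K_d^{\mathrm{msc}}/K_\theta^{\mathrm{msc}}$. Then the system is asymptotically stable with respect to the origin.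
   Context: The system is the small-signal (linearized) model of one synchronous generator with turbine/governor connected to one wind turbine with permanent magnet synchronous generator (PMSG) and back-to-back converters (grid-side converter, GSC, and machine-side converter, MSC). Interpretation of the symbols (not needed for the mathematical statement): $\varrho_\delta=(\theta_{\mathrm{gsc}}-\theta_{\mathrm g},\theta_{\mathrm{msc}}-\theta_r)$ are phase angle differences between the GSC and the synchronous generator and between the MSC and the PMSG; $\omega_\delta=(\omega_{\delta,\mathrm g},\omega_{\delta,r})$ are the frequency deviations of the synchronous generator and the PMSG; $v_{\delta,\mathrm{dc}}$ is the DC-link voltage deviation; $P_{\delta,\mathrm g}$ is the turbine power deviation of the synchronous generator; $b_{\mathrm g},b_{\mathrm{msc}}$ are susceptances; $C_{\mathrm{dc}}$ is the DC-link capacitance; $J_{\mathrm g},J_{\mathrm{wt}}$ are inertias; $T_{\mathrm g},k_{\mathrm g}$ are the turbine/governor time constant and gain; $\omega_0$ is the nominal grid frequency and $\omega_r^{\mathrm{del}}$ the curtailed rotor speed; $K_\theta^{\mathrm{gsc}},K_\theta^{\mathrm{msc}}$ and $K_d^{\mathrm{gsc}},K_d^{\mathrm{msc}}$ are proportional and derivative control gains; $K_{\omega_r},K_\beta$ are sensitivities of the wind turbine power to rotor speed and pitch angle; $K_p$ is the pitch control gain. A linear system $\dot x = Ax$ is asymptotically stable with respect to the origin if the origin is Lyapunov stable and every solution converges to the origin as $t\to\infty$ (equivalently, all eigenvalues of $A$ have negative real part). *)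

theory Defs
  imports "HOL-Analysis.Analysis"
begin

text \<open>Forward solutions of \<open>E (dx/dt) = M x\<close> on \<open>[0, \<infinity>)\<close>; the derivative at \<open>t = 0\<close> is one-sided.\<close>

definition is_solution ::
  "('a::real_normed_vector \<Rightarrow> 'a) \<Rightarrow> ('a \<Rightarrow> 'a) \<Rightarrow> (real \<Rightarrow> 'a) \<Rightarrow> bool" where
  "is_solution E M x \<longleftrightarrow>
     (\<forall>t\<ge>0. \<exists>x'. (x has_vector_derivative x') (at t within {0..}) \<and> E x' = M (x t))"

text \<open>
  Since the system is autonomous, taking the initial time to be \<open>0\<close> is no restriction.
  The definition quantifies over solutions and is meant for invertible \<open>E\<close>, where every
  initial value has exactly one solution.
\<close>

definition lyapunov_stable_origin ::
  "('a::real_normed_vector \<Rightarrow> 'a) \<Rightarrow> ('a \<Rightarrow> 'a) \<Rightarrow> bool" where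
  "lyapunov_stable_origin E M \<longleftrightarrow>
     (\<forall>\<epsilon>>0. \<exists>\<delta>>0. \<forall>x. is_solution E M x \<longrightarrow> norm (x 0) < \<delta> \<longrightarrow> (\<forall>t\<ge>0. norm (x t) < \<epsilon>))"

definition asymptotically_stable_origin ::
  "('a::real_normed_vector \<Rightarrow> 'a) \<Rightarrow> ('a \<Rightarrow> 'a) \<Rightarrow> bool" where
  "asymptotically_stable_origin E M \<longleftrightarrow>
     lyapunov_stable_origin E M \<and> (\<forall>x. is_solution E M x \<longrightarrow> (x \<longlongrightarrow> 0) at_top)"

definition diag2 :: "real \<Rightarrow> real \<Rightarrow> real ^ 2 ^ 2" where
  "diag2 a b = vector [vector [a, 0], vector [0, b]]"

definition ones2 :: "real ^ 2" where
  "ones2 = vector [1, 1]"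

definition ones22 :: "real ^ 2 ^ 2" where
  "ones22 = (\<chi> i j. ones2 $ i * ones2 $ j)"

definition e2 :: "real ^ 2" where
  "e2 = vector [1, 0]"

type_synonym state = "(real ^ 2) \<times> (real ^ 2) \<times> real \<times> real"

text \<open>
  The \<open>6 \<times> 6\<close> block matrices are given by their action on the block vector
  \<open>(\<rho>, \<omega>, v, P)\<close>, one component per block row. A row block \<open>r\<^sup>T\<close> acts as \<open>r \<bullet> _\<close>,
  and a column block \<open>c\<close> acts on a scalar \<open>s\<close> as \<open>s *\<^sub>R c\<close>.
\<close>

definition mass_map :: "real ^ 2 ^ 2 \<Rightarrow> real \<Rightarrow> real \<Rightarrow> state \<Rightarrow> state" where
  "mass_map J Cdc Tg = (\<lambda>(\<rho>, \<omega>, v, P). (\<rho>, J *v \<omega>, Cdc * v, Tg * P))"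

definition system_map ::
  "real ^ 2 ^ 2 \<Rightarrow> real ^ 2 ^ 2 \<Rightarrow> real ^ 2 ^ 2 \<Rightarrow> real ^ 2 ^ 2 \<Rightarrow> real \<Rightarrow> state \<Rightarrow> state" where
  "system_map Kd' K\<theta> B Kwt kg = (\<lambda>(\<rho>, \<omega>, v, P).
     (- ((Kd' ** ones22 ** B) *v \<rho>) - \<omega> + v *\<^sub>R (K\<theta> *v ones2),
      B *v \<rho> - Kwt *v \<omega> + P *\<^sub>R e2,
      - ((ones2 v* B) \<bullet> \<rho>),
      - kg * (e2 \<bullet> \<omega>) - P))"

end

theory Submission
  imports Defs "HOL-Library.Landau_Symbols"
begin

text \<open>
  Index \<open>1\<close> stands for the GSC and the synchronous generator, index \<open>2\<close> for the MSC and the PMSG.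
  Since \<open>\<kappa> = K\<^sub>d / K\<^sub>\<theta>\<close> is the same for both converters, weighting the energy of each machine by
  the inverse of its gain \<open>K\<^sub>\<theta>\<close> cancels all indefinite terms: twice the weighted energy, \<open>V\<close>, satisfies
  \<open>V' = - 2 (\<kappa>/C s\<^sup>2 + D/K\<^sub>2 \<omega>\<^sub>2\<^sup>2 + P\<^sup>2/(k K\<^sub>1))\<close> with \<open>s = b\<^sub>1 \<rho>\<^sub>1 + b\<^sub>2 \<rho>\<^sub>2\<close>. This gives Lyapunov stability.
  By Barbalat's lemma \<open>V' \<rightarrow> 0\<close>, hence \<open>s \<rightarrow> 0\<close> and \<open>P \<rightarrow> 0\<close>. Applying Barbalat's lemma again, the
  derivative of every vanishing component vanishes, which successively yields
  \<open>P' \<rightarrow> 0\<close> and \<open>\<omega>\<^sub>1 \<rightarrow> 0\<close>; \<open>\<omega>\<^sub>1' \<rightarrow> 0\<close> and \<open>\<rho>\<^sub>1 \<rightarrow> 0\<close>; \<open>\<rho>\<^sub>2 \<rightarrow> 0\<close>; \<open>\<rho>\<^sub>1' \<rightarrow> 0\<close> and \<open>v \<rightarrow> 0\<close>;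
  \<open>\<rho>\<^sub>2' \<rightarrow> 0\<close> and \<open>\<omega>\<^sub>2 \<rightarrow> 0\<close>.
\<close>

section \<open>Limits of real functions at infinity\<close>

text \<open>By the mean value theorem, a small increment of \<open>f\<close> over a short window
  forces \<open>g\<close> to be small somewhere in it, and the bound on \<open>h\<close> keeps
  \<open>g\<close> close to that value. Boundedness of \<open>h\<close> stands in for uniform
  continuity of \<open>g\<close>.\<close>

lemma barbalat:
  fixes f g h :: "real \<Rightarrow> real"
  assumes f: "eventually (\<lambda>t. (f has_real_derivative g t) (at t)) at_top"
    and g: "eventually (\<lambda>t. (g has_real_derivative h t) (at t)) at_top"
    and h: "h \<in> O[at_top](\<lambda>_. 1)"
    and lim: "(f \<longlongrightarrow> l) at_top"
  shows "(g \<longlongrightarrow> 0) at_top"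
proof (rule tendstoI)
  fix e :: real
  assume e: "e > 0"
  obtain c where c: "c > 0" and hc: "eventually (\<lambda>t. \<bar>h t\<bar> \<le> c) at_top"
    using landau_o.bigE[OF h] by auto
  obtain t0 where t0: "\<And>t. t \<ge> t0 \<Longrightarrow> (f has_real_derivative g t) (at t)"
    "\<And>t. t \<ge> t0 \<Longrightarrow> (g has_real_derivative h t) (at t)" "\<And>t. t \<ge> t0 \<Longrightarrow> \<bar>h t\<bar> \<le> c"
    using eventually_conj[OF f eventually_conj[OF g hc]] by (auto simp: eventually_at_top_linorder)
  \<comment> \<open>Over a window of length \<open>\<eta>\<close> the slope bound \<open>c\<close>
    lets \<open>g\<close> change by at most \<open>e / 2\<close>.\<close>
  define \<eta> where "\<eta> = e / (2 * c)"
  have \<eta>: "\<eta> > 0" using e c by (simp add: \<eta>_def)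
  have "filterlim (\<lambda>t. t + \<eta>) at_top at_top"
    by (subst add.commute) (rule filterlim_tendsto_add_at_top[OF tendsto_const filterlim_ident])
  then have "((\<lambda>t. f (t + \<eta>) - f t) \<longlongrightarrow> l - l) at_top"
    by (intro tendsto_diff lim filterlim_compose[OF lim])
  then have small: "eventually (\<lambda>t. \<bar>f (t + \<eta>) - f t\<bar> < \<eta> * e / 2) at_top"
    using \<eta> e by (auto dest!: tendstoD[where e = "\<eta> * e / 2"] simp: dist_real_def)
  show "eventually (\<lambda>t. dist (g t) 0 < e) at_top"
    using small eventually_ge_at_top[of t0]
  proof eventually_elim
    case (elim t)
    obtain z where z: "t < z" "z < t + \<eta>" "f (t + \<eta>) - f t = (t + \<eta> - t) * g z"
      using MVT2[of t "t + \<eta>" f g] \<eta> t0(1) elim(2) by auto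
    obtain y where y: "t < y" "y < z" "g z - g t = (z - t) * h y"
      using MVT2[of t z g h] z t0(2) elim(2) by auto
    have "\<bar>g z - g t\<bar> \<le> \<eta> * c"
      unfolding y(3) abs_mult using y z t0(3)[of y] elim(2) c by (intro mult_mono) auto
    moreover have "\<eta> * c = e / 2" using c by (simp add: \<eta>_def)
    moreover have "\<bar>g z\<bar> < e / 2"
      using elim(1) z(3) \<eta> by (simp add: abs_mult)
    ultimately show ?case unfolding dist_real_def by linarith
  qed
qed

lemma decreasing_bounded_below_convergent:
  fixes f :: "real \<Rightarrow> real"
  assumes dec: "\<And>s t. a \<le> s \<Longrightarrow> s \<le> t \<Longrightarrow> f t \<le> f s"
    and bound: "\<And>t. a \<le> t \<Longrightarrow> B \<le> f t"
  obtains l where "(f \<longlongrightarrow> l) at_top"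
proof -
  have bdd: "bdd_below (f ` {a..})" using bound by (auto intro!: bdd_belowI[of _ B])
  have "(f \<longlongrightarrow> (INF t\<in>{a..}. f t)) at_top"
  proof (rule order_tendstoI)
    fix y assume "y < (INF t\<in>{a..}. f t)"
    then have "y < f t" if "t \<ge> a" for t
      using cINF_lower[OF bdd, of t] that by auto
    then show "eventually (\<lambda>t. y < f t) at_top" by (auto simp: eventually_at_top_linorder)
  next
    fix y assume "(INF t\<in>{a..}. f t) < y"
    then obtain s where "s \<ge> a" "f s < y" using cINF_less_iff[OF _ bdd] by auto
    then have "f t < y" if "t \<ge> s" for t
      using dec[of s t] that by linarith
    then show "eventually (\<lambda>t. f t < y) at_top"
      by (auto simp: eventually_at_top_linorder)
  qed
  then show thesis by (rule that)
qed

lemma tendsto_zero_if_le_square: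
  fixes f g :: "real \<Rightarrow> real"
  assumes "(g \<longlongrightarrow> 0) F" "c > 0" "\<And>t. c * (f t)\<^sup>2 \<le> \<bar>g t\<bar>"
  shows "(f \<longlongrightarrow> 0) F"
proof -
  have "((\<lambda>t. sqrt (\<bar>g t\<bar> / c)) \<longlongrightarrow> sqrt (\<bar>0\<bar> / c)) F"
    using assms(2) by (intro tendsto_intros assms(1)) simp
  moreover have "norm (f t) \<le> sqrt (\<bar>g t\<bar> / c)" for t
    using assms(2) assms(3)[of t] by (intro real_le_rsqrt) (simp add: field_simps)
  ultimately show ?thesis
    by (intro Lim_null_comparison[of f "\<lambda>t. sqrt (\<bar>g t\<bar> / c)"]) simp_all
qed

section \<open>Scalar equations and the weighted energy\<close>

text \<open>
  The right-hand sides use \<open>- 1 * x\<close> and \<open>inverse M * x\<close> because these shapes match the closure rules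
  for bounded functions (sums and products).
\<close>

locale trajectory =
  fixes b1 b2 K1 K2 \<kappa> C M1 M2 D T k :: real
    and r1 r2 w1 w2 v p :: "real \<Rightarrow> real"
    and s dr1 dr2 dw1 dw2 dv dp :: "real \<Rightarrow> real"
  defines "s \<equiv> \<lambda>t. b1 * r1 t + b2 * r2 t"
    and "dr1 \<equiv> \<lambda>t. - 1 * w1 t + K1 * (v t - \<kappa> / C * s t)"
    and "dr2 \<equiv> \<lambda>t. - 1 * w2 t + K2 * (v t - \<kappa> / C * s t)"
    and "dw1 \<equiv> \<lambda>t. inverse M1 * (b1 * r1 t + p t)"
    and "dw2 \<equiv> \<lambda>t. inverse M2 * (b2 * r2 t - D * w2 t)"
    and "dv \<equiv> \<lambda>t. - inverse C * s t"
    and "dp \<equiv> \<lambda>t. inverse T * (- k * w1 t - p t)"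
  assumes pos: "b1 > 0" "b2 > 0" "K1 > 0" "K2 > 0" "\<kappa> > 0" "C > 0" "M1 > 0" "M2 > 0"
      "T > 0" "k > 0" "D \<ge> 0"
    and deriv:
      "\<And>t. t \<ge> 0 \<Longrightarrow> (r1 has_real_derivative dr1 t) (at t within {0..})"
      "\<And>t. t \<ge> 0 \<Longrightarrow> (r2 has_real_derivative dr2 t) (at t within {0..})"
      "\<And>t. t \<ge> 0 \<Longrightarrow> (w1 has_real_derivative dw1 t) (at t within {0..})"
      "\<And>t. t \<ge> 0 \<Longrightarrow> (w2 has_real_derivative dw2 t) (at t within {0..})"
      "\<And>t. t \<ge> 0 \<Longrightarrow> (v has_real_derivative dv t) (at t within {0..})"
      "\<And>t. t \<ge> 0 \<Longrightarrow> (p has_real_derivative dp t) (at t within {0..})"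
begin

text \<open>The extra factor \<open>1 / k\<close> on the governor term makes its exchange with
  \<open>w1\<close> cancel.\<close>

definition V :: "real \<Rightarrow> real" where
  "V t = b1 / K1 * (r1 t)\<^sup>2 + b2 / K2 * (r2 t)\<^sup>2 + M1 / K1 * (w1 t)\<^sup>2 + M2 / K2 * (w2 t)\<^sup>2
    + C * (v t)\<^sup>2 + T / (k * K1) * (p t)\<^sup>2"

definition dV :: "real \<Rightarrow> real" where
  "dV t = - 2 * (\<kappa> / C * (s t)\<^sup>2 + D / K2 * (w2 t)\<^sup>2 + inverse (k * K1) * (p t)\<^sup>2)"

lemma deriv_at:
  assumes "t > 0"
  shows "(r1 has_real_derivative dr1 t) (at t)" "(r2 has_real_derivative dr2 t) (at t)"
    "(w1 has_real_derivative dw1 t) (at t)" "(w2 has_real_derivative dw2 t) (at t)"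
    "(v has_real_derivative dv t) (at t)" "(p has_real_derivative dp t) (at t)"
proof -
  have *: "at t within {0..} = at t"
    using assms by (intro at_within_interior) simp
  show "(r1 has_real_derivative dr1 t) (at t)" "(r2 has_real_derivative dr2 t) (at t)"
    "(w1 has_real_derivative dw1 t) (at t)" "(w2 has_real_derivative dw2 t) (at t)"
    "(v has_real_derivative dv t) (at t)" "(p has_real_derivative dp t) (at t)"
    using deriv[of t] assms unfolding * by auto
qed

text \<open>Products of \<open>r1\<close> with \<open>w1\<close> and of \<open>r2\<close> with
  \<open>w2\<close> cancel within each machine, \<open>p * w1\<close> cancels against the governor
  and \<open>s * v\<close> against the DC link. The common ratio \<open>\<kappa>\<close> turns the
  converter damping into a multiple of the square of \<open>s\<close>.\<close>

lemma V_deriv: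
  assumes "t > 0"
  shows "(V has_real_derivative dV t) (at t)"
proof -
  have "dV t = b1 / K1 * (2 * r1 t * dr1 t) + b2 / K2 * (2 * r2 t * dr2 t)
      + M1 / K1 * (2 * w1 t * dw1 t) + M2 / K2 * (2 * w2 t * dw2 t)
      + C * (2 * v t * dv t) + T / (k * K1) * (2 * p t * dp t)"
    using pos unfolding dV_def dr1_def dr2_def dw1_def dw2_def dv_def dp_def s_def
    by (simp add: field_simps power2_eq_square)
  then show ?thesis
    using pos unfolding V_def[abs_def]
    by (auto intro!: derivative_eq_intros deriv_at[OF assms] simp: algebra_simps)
qed

text \<open>Serves to pass the decay of \<open>dV\<close> on to \<open>s\<close> and
  \<open>p\<close>. The term in \<open>w2\<close> gives no such control, since \<open>D = 0\<close>
  is allowed.\<close>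

lemma dV_le:
  "\<kappa> / C * (s t)\<^sup>2 \<le> - dV t" "inverse (k * K1) * (p t)\<^sup>2 \<le> - dV t" "dV t \<le> 0"
proof -
  define A B E where "A = \<kappa> / C * (s t)\<^sup>2" and "B = D / K2 * (w2 t)\<^sup>2"
    and "E = inverse (k * K1) * (p t)\<^sup>2"
  have "A \<ge> 0" "B \<ge> 0" "E \<ge> 0" "dV t = - 2 * (A + B + E)"
    using pos by (simp_all add: A_def B_def E_def dV_def)
  then have "A \<le> - dV t" "E \<le> - dV t" "dV t \<le> 0"
    by auto
  then show "\<kappa> / C * (s t)\<^sup>2 \<le> - dV t" "inverse (k * K1) * (p t)\<^sup>2 \<le> - dV t" "dV t \<le> 0"
    by (simp_all only: A_def E_def)
qed

text \<open>At time \<open>0\<close> derivatives are only one-sided, so continuity on the closed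
  interval is combined with the sign of the derivative in its interior.\<close>

lemma V_decreasing:
  assumes "0 \<le> a" "a \<le> b"
  shows "V b \<le> V a"
proof -
  have cont: "continuous_on {0..} r1" "continuous_on {0..} r2" "continuous_on {0..} w1"
    "continuous_on {0..} w2" "continuous_on {0..} v" "continuous_on {0..} p"
    by (rule DERIV_continuous_on, rule deriv, simp)+
  have "continuous_on {0..} V"
    unfolding V_def[abs_def] by (intro continuous_intros cont)
  then have "continuous_on {a..b} V"
    by (rule continuous_on_subset) (use assms in auto)
  then show ?thesis
    using assms(2)
    by (rule DERIV_nonpos_imp_decreasing_open[rotated -1])
      (use assms(1) V_deriv dV_le(3) in \<open>meson order_le_less_trans\<close>)
qed

lemma V_ge:
  "b1 / K1 * (r1 t)\<^sup>2 \<le> V t" "b2 / K2 * (r2 t)\<^sup>2 \<le> V t"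
  "M1 / K1 * (w1 t)\<^sup>2 \<le> V t" "M2 / K2 * (w2 t)\<^sup>2 \<le> V t"
  "C * (v t)\<^sup>2 \<le> V t" "T / (k * K1) * (p t)\<^sup>2 \<le> V t"
proof -
  have nonneg: "0 \<le> b1 / K1 * (r1 t)\<^sup>2"
    "0 \<le> b2 / K2 * (r2 t)\<^sup>2"
    "0 \<le> M1 / K1 * (w1 t)\<^sup>2"
    "0 \<le> M2 / K2 * (w2 t)\<^sup>2"
    "0 \<le> C * (v t)\<^sup>2"
    "0 \<le> T / (k * K1) * (p t)\<^sup>2"
    using pos by simp_all
  have le_sum: "a \<le> a + b + c + d + e + f" "b \<le> a + b + c + d + e + f" "c \<le> a + b + c + d + e + f"
    "d \<le> a + b + c + d + e + f" "e \<le> a + b + c + d + e + f" "f \<le> a + b + c + d + e + f"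
    if "a \<ge> 0" "b \<ge> 0" "c \<ge> 0" "d \<ge> 0" "e \<ge> 0" "f \<ge> 0" for a b c d e f :: real
    using that by simp_all
  show "b1 / K1 * (r1 t)\<^sup>2 \<le> V t"
    "b2 / K2 * (r2 t)\<^sup>2 \<le> V t"
    "M1 / K1 * (w1 t)\<^sup>2 \<le> V t"
    "M2 / K2 * (w2 t)\<^sup>2 \<le> V t"
    "C * (v t)\<^sup>2 \<le> V t"
    "T / (k * K1) * (p t)\<^sup>2 \<le> V t"
    unfolding V_def by (rule le_sum; rule nonneg)+
qed

lemma V_nonneg: "V t \<ge> 0"
  using pos unfolding V_def by simp

lemma V_tendsto: obtains l where "(V \<longlongrightarrow> l) at_top"
  using decreasing_bounded_below_convergent[of 0 V 0] V_decreasing V_nonneg by blast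

section \<open>Boundedness and convergence of trajectories\<close>

lemma bounded_if_le_V:
  assumes "c > 0" "\<And>t. c * (f t)\<^sup>2 \<le> V t"
  shows "f \<in> O[at_top](\<lambda>_. 1)"
proof -
  have "norm (f t) \<le> sqrt (V 0 / c) * norm (1::real)" if "t \<ge> 0" for t
  proof -
    have "c * (f t)\<^sup>2 \<le> V 0" using assms(2)[of t] V_decreasing[of 0 t] that by linarith
    then have "(f t)\<^sup>2 \<le> V 0 / c" using assms(1) by (simp add: field_simps)
    then show ?thesis by (simp add: real_le_rsqrt)
  qed
  then show ?thesis
    by (intro bigoI[of _ "sqrt (V 0 / c)"]) (auto simp: eventually_at_top_linorder)
qed

lemma state_bounded:
  "r1 \<in> O[at_top](\<lambda>_. 1)" "r2 \<in> O[at_top](\<lambda>_. 1)" "w1 \<in> O[at_top](\<lambda>_. 1)"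
  "w2 \<in> O[at_top](\<lambda>_. 1)" "v \<in> O[at_top](\<lambda>_. 1)" "p \<in> O[at_top](\<lambda>_. 1)"
  by (rule bounded_if_le_V[rotated], rule V_ge, use pos in simp)+

lemmas bounded_intros = sum_in_bigo landau_o.big.mult_in_1 state_bounded

lemma s_bounded: "s \<in> O[at_top](\<lambda>_. 1)"
  unfolding s_def by (intro bounded_intros) simp_all

lemma deriv_bounded:
  "dr1 \<in> O[at_top](\<lambda>_. 1)" "dr2 \<in> O[at_top](\<lambda>_. 1)" "dw1 \<in> O[at_top](\<lambda>_. 1)"
  "dw2 \<in> O[at_top](\<lambda>_. 1)" "dv \<in> O[at_top](\<lambda>_. 1)" "dp \<in> O[at_top](\<lambda>_. 1)"
  unfolding dr1_def dr2_def dw1_def dw2_def dv_def dp_def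
  by (intro bounded_intros s_bounded; simp)+

lemma s_deriv: "t > 0 \<Longrightarrow> (s has_real_derivative b1 * dr1 t + b2 * dr2 t) (at t)"
  unfolding s_def by (auto intro!: derivative_eq_intros deriv_at)

text \<open>Barbalat's lemma applies to \<open>V\<close>: it is decreasing and nonnegative, hence
  convergent, and its second derivative \<open>?h\<close> is a polynomial in bounded
  functions.\<close>

lemma dV_tendsto: "(dV \<longlongrightarrow> 0) at_top"
proof -
  obtain l where "(V \<longlongrightarrow> l) at_top" by (rule V_tendsto)
  moreover let ?h = "\<lambda>t. - 2 * (\<kappa> / C * (2 * s t * (b1 * dr1 t + b2 * dr2 t))
      + D / K2 * (2 * w2 t * dw2 t) + inverse (k * K1) * (2 * p t * dp t))"
  have "(dV has_real_derivative ?h t) (at t)" if "t > 0" for t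
    unfolding dV_def[abs_def] using pos
    by (auto intro!: derivative_eq_intros deriv_at[OF that] s_deriv[OF that] simp: field_simps)
  moreover have "?h \<in> O[at_top](\<lambda>_. 1)"
    by (intro bounded_intros s_bounded deriv_bounded) simp_all
  ultimately show ?thesis
    using V_deriv by (intro barbalat[of V dV ?h]) (auto intro: eventually_mono[OF eventually_gt_at_top[of 0]])
qed

lemma tendsto_deriv:
  fixes f g h :: "real \<Rightarrow> real"
  assumes "(f \<longlongrightarrow> 0) at_top" "\<And>t. t > 0 \<Longrightarrow> (f has_real_derivative g t) (at t)"
    "\<And>t. t > 0 \<Longrightarrow> (g has_real_derivative h t) (at t)" "h \<in> O[at_top](\<lambda>_. 1)"
  shows "(g \<longlongrightarrow> 0) at_top"
  using assms by (intro barbalat[of f g h]) (auto intro: eventually_mono[OF eventually_gt_at_top[of 0]])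

text \<open>Plays the role of LaSalle's invariance principle: an equation whose derivative vanishes
  is solved for the one component not yet known to vanish.\<close>

lemma state_tendsto:
  "(r1 \<longlongrightarrow> 0) at_top" "(r2 \<longlongrightarrow> 0) at_top" "(w1 \<longlongrightarrow> 0) at_top"
  "(w2 \<longlongrightarrow> 0) at_top" "(v \<longlongrightarrow> 0) at_top" "(p \<longlongrightarrow> 0) at_top"
proof -
  have s: "(s \<longlongrightarrow> 0) at_top"
    using pos by (intro tendsto_zero_if_le_square[OF dV_tendsto, of "\<kappa> / C"])
      (simp, rule order_trans[OF dV_le(1) abs_ge_minus_self])
  show p: "(p \<longlongrightarrow> 0) at_top"
    using pos by (intro tendsto_zero_if_le_square[OF dV_tendsto, of "inverse (k * K1)"])
      (simp, rule order_trans[OF dV_le(2) abs_ge_minus_self])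
  have "(dp \<longlongrightarrow> 0) at_top"
  proof (rule tendsto_deriv[OF p deriv_at(6)])
    show "(dp has_real_derivative inverse T * (- k * dw1 t - dp t)) (at t)" if "t > 0" for t
      using pos unfolding dp_def by (auto intro!: derivative_eq_intros deriv_at[OF that] simp: dp_def field_simps)
    show "(\<lambda>t. inverse T * (- k * dw1 t - dp t)) \<in> O[at_top](\<lambda>_. 1)"
      by (intro bounded_intros deriv_bounded) simp_all
  qed
  \<comment> \<open>The governor equation solved for \<open>w1\<close>.\<close>
  then have "((\<lambda>t. - (T * dp t + p t) / k) \<longlongrightarrow> - (T * 0 + 0) / k) at_top"
    using pos by (intro tendsto_intros p) auto
  then show w1: "(w1 \<longlongrightarrow> 0) at_top" using pos by (simp add: dp_def field_simps)
  have "(dw1 \<longlongrightarrow> 0) at_top"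
  proof (rule tendsto_deriv[OF w1 deriv_at(3)])
    show "(dw1 has_real_derivative inverse M1 * (b1 * dr1 t + dp t)) (at t)" if "t > 0" for t
      using pos unfolding dw1_def by (auto intro!: derivative_eq_intros deriv_at[OF that] simp: field_simps)
    show "(\<lambda>t. inverse M1 * (b1 * dr1 t + dp t)) \<in> O[at_top](\<lambda>_. 1)"
      by (intro bounded_intros deriv_bounded) simp_all
  qed
  \<comment> \<open>The swing equation of the generator solved for \<open>r1\<close>.\<close>
  then have "((\<lambda>t. (M1 * dw1 t - p t) / b1) \<longlongrightarrow> (M1 * 0 - 0) / b1) at_top"
    using pos by (intro tendsto_intros p) auto
  then show r1: "(r1 \<longlongrightarrow> 0) at_top" using pos by (simp add: dw1_def field_simps)
  have "((\<lambda>t. (s t - b1 * r1 t) / b2) \<longlongrightarrow> (0 - b1 * 0) / b2) at_top"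
    using pos by (intro tendsto_intros s r1) auto
  then show r2: "(r2 \<longlongrightarrow> 0) at_top" using pos by (simp add: s_def field_simps)
  have "(dr1 \<longlongrightarrow> 0) at_top"
  proof (rule tendsto_deriv[OF r1 deriv_at(1)])
    show "(dr1 has_real_derivative - 1 * dw1 t + K1 * (dv t - \<kappa> / C * (b1 * dr1 t + b2 * dr2 t))) (at t)"
      if "t > 0" for t
      using DERIV_add[OF DERIV_cmult[OF deriv_at(3)[OF that], of "- 1"]
          DERIV_cmult[OF DERIV_diff[OF deriv_at(5)[OF that]
            DERIV_cmult[OF s_deriv[OF that], of "\<kappa> / C"]], of K1]]
      unfolding dr1_def by assumption
    show "(\<lambda>t. - 1 * dw1 t + K1 * (dv t - \<kappa> / C * (b1 * dr1 t + b2 * dr2 t))) \<in> O[at_top](\<lambda>_. 1)"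
      by (intro bounded_intros deriv_bounded) simp_all
  qed
  \<comment> \<open>The GSC phase equation solved for \<open>v\<close>.\<close>
  then have "((\<lambda>t. (dr1 t + w1 t) / K1 + \<kappa> / C * s t) \<longlongrightarrow> (0 + 0) / K1 + \<kappa> / C * 0) at_top"
    using pos by (intro tendsto_intros w1 s) auto
  then show v: "(v \<longlongrightarrow> 0) at_top" using pos by (simp add: dr1_def)
  have "(dr2 \<longlongrightarrow> 0) at_top"
  proof (rule tendsto_deriv[OF r2 deriv_at(2)])
    show "(dr2 has_real_derivative - 1 * dw2 t + K2 * (dv t - \<kappa> / C * (b1 * dr1 t + b2 * dr2 t))) (at t)"
      if "t > 0" for t
      using DERIV_add[OF DERIV_cmult[OF deriv_at(4)[OF that], of "- 1"]
          DERIV_cmult[OF DERIV_diff[OF deriv_at(5)[OF that]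
            DERIV_cmult[OF s_deriv[OF that], of "\<kappa> / C"]], of K2]]
      unfolding dr2_def by assumption
    show "(\<lambda>t. - 1 * dw2 t + K2 * (dv t - \<kappa> / C * (b1 * dr1 t + b2 * dr2 t))) \<in> O[at_top](\<lambda>_. 1)"
      by (intro bounded_intros deriv_bounded) simp_all
  qed
  \<comment> \<open>\<open>w2\<close> is recovered from the MSC phase equation and not from
    dissipation, which covers \<open>D = 0\<close>.\<close>
  then have "((\<lambda>t. K2 * (v t - \<kappa> / C * s t) - dr2 t) \<longlongrightarrow> K2 * (0 - \<kappa> / C * 0) - 0) at_top"
    by (intro tendsto_intros v s)
  then show "(w2 \<longlongrightarrow> 0) at_top" by (simp add: dr2_def)
qed

section \<open>Comparison of energy and norm\<close>

text \<open>The weights of \<open>V\<close>; their extremes compare \<open>V\<close> with the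
  squared Euclidean norm.\<close>

definition W where
  "W = {b1 / K1, b2 / K2, M1 / K1, M2 / K2, C, T / (k * K1)}"

lemma sum_squares_bound:
  assumes "t \<ge> 0"
  shows "Min W * ((r1 t)\<^sup>2 + (r2 t)\<^sup>2 + (w1 t)\<^sup>2 + (w2 t)\<^sup>2 + (v t)\<^sup>2 + (p t)\<^sup>2)
    \<le> Max W * ((r1 0)\<^sup>2 + (r2 0)\<^sup>2 + (w1 0)\<^sup>2 + (w2 0)\<^sup>2 + (v 0)\<^sup>2 + (p 0)\<^sup>2)"
proof -
  have "Min W * ((r1 t)\<^sup>2 + (r2 t)\<^sup>2 + (w1 t)\<^sup>2 + (w2 t)\<^sup>2 + (v t)\<^sup>2 + (p t)\<^sup>2) \<le> V t"
    unfolding V_def distrib_left W_def by (intro add_mono mult_right_mono Min_le) auto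
  also have "\<dots> \<le> V 0" using V_decreasing[of 0 t] assms by simp
  also have "\<dots> \<le> Max W * ((r1 0)\<^sup>2 + (r2 0)\<^sup>2 + (w1 0)\<^sup>2 + (w2 0)\<^sup>2 + (v 0)\<^sup>2 + (p 0)\<^sup>2)"
    unfolding V_def distrib_left W_def by (intro add_mono mult_right_mono Max_ge) auto
  finally show ?thesis .
qed

end

section \<open>Transfer to the block system\<close>

text \<open>Product and vector norms are both Euclidean, so nesting them gives the Euclidean norm of
  the six coordinates.\<close>

lemma norm_state_sq:
  "(norm x)\<^sup>2 = (fst x $ 1)\<^sup>2 + (fst x $ 2)\<^sup>2 + (fst (snd x) $ 1)\<^sup>2 + (fst (snd x) $ 2)\<^sup>2
    + (fst (snd (snd x)))\<^sup>2 + (snd (snd (snd x)))\<^sup>2" for x :: state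
proof -
  have vec2: "(norm y)\<^sup>2 = (y $ 1)\<^sup>2 + (y $ 2)\<^sup>2" for y :: "real ^ 2"
    by (simp add: norm_vec_def L2_set_def sum_2)
  show ?thesis
    by (cases x) (simp add: norm_Pair vec2)
qed

text \<open>Coordinate projections are bounded linear and so commute with differentiation; the mass
  matrix is diagonal with positive entries, so each row can be solved for its derivative.\<close>

lemma solution_trajectory:
  fixes x :: "real \<Rightarrow> state"
  assumes pos: "b_g > 0" "b_msc > 0" "C > 0" "M1 > 0" "M2 > 0" "T > 0" "k > 0" "K1 > 0" "K2 > 0"
      "\<kappa> > 0" "D \<ge> 0"
    and sol: "is_solution (mass_map (diag2 M1 M2) C T)
      (system_map (diag2 (\<kappa> * K1 / C) (\<kappa> * K2 / C)) (diag2 K1 K2) (diag2 b_g b_msc) (diag2 0 D) k) x"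
  shows "trajectory b_g b_msc K1 K2 \<kappa> C M1 M2 D T k
    (\<lambda>t. fst (x t) $ 1) (\<lambda>t. fst (x t) $ 2) (\<lambda>t. fst (snd (x t)) $ 1) (\<lambda>t. fst (snd (x t)) $ 2)
    (\<lambda>t. fst (snd (snd (x t)))) (\<lambda>t. snd (snd (snd (x t))))"
proof -
  have comp: "((\<lambda>t. h (x t)) has_real_derivative d) (at t within {0..})"
    if t: "t \<ge> 0" and h: "bounded_linear h" and eq:
      "\<And>x'. mass_map (diag2 M1 M2) C T x' =
        system_map (diag2 (\<kappa> * K1 / C) (\<kappa> * K2 / C)) (diag2 K1 K2) (diag2 b_g b_msc) (diag2 0 D) k (x t)
        \<Longrightarrow> h x' = d"
    for t d and h :: "state \<Rightarrow> real"
  proof -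
    obtain x' where x': "(x has_vector_derivative x') (at t within {0..})"
      and M: "mass_map (diag2 M1 M2) C T x' =
        system_map (diag2 (\<kappa> * K1 / C) (\<kappa> * K2 / C)) (diag2 K1 K2) (diag2 b_g b_msc) (diag2 0 D) k (x t)"
      using sol t unfolding is_solution_def by blast
    show ?thesis
      using bounded_linear.has_vector_derivative[OF h x'] unfolding eq[OF M]
      by (simp add: has_real_derivative_iff_has_vector_derivative)
  qed
  note bl = bounded_linear_compose[OF bounded_linear_vec_nth]
    bounded_linear_fst_comp bounded_linear_snd_comp bounded_linear_ident
  note simps = mass_map_def system_map_def diag2_def ones2_def ones22_def e2_def
    matrix_vector_mult_def matrix_matrix_mult_def vector_matrix_mult_def inner_vec_def sum_2
    vec_eq_iff forall_2 split_beta prod_eq_iff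
  show ?thesis
    by (unfold_locales; (rule pos | (rule comp, assumption,
      (intro bl; fail), use pos in \<open>auto simp: simps field_simps\<close>)))
qed

theorem theorem1:
  fixes b_g b_msc C_dc J_g J_wt T_g k_g \<omega>\<^sub>0 \<omega>_r_del :: real
    and K\<theta>_gsc K\<theta>_msc Kd_gsc Kd_msc :: real
    and K\<omega>_r K\<beta> K_p :: real
  assumes "b_g > 0" "b_msc > 0" "C_dc > 0" "J_g > 0" "J_wt > 0" "T_g > 0" "k_g > 0"
    and "\<omega>\<^sub>0 > 0" "\<omega>_r_del > 0"
    and "K\<theta>_gsc > 0" "K\<theta>_msc > 0" "Kd_gsc > 0" "Kd_msc > 0"
    and "K_p \<ge> 0"
    and "K\<omega>_r + K\<beta> * K_p \<ge> 0"
    and "Kd_gsc / K\<theta>_gsc = Kd_msc / K\<theta>_msc"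
  shows "asymptotically_stable_origin
    (mass_map (diag2 (J_g * \<omega>\<^sub>0) (J_wt * \<omega>_r_del)) C_dc T_g)
    (system_map (diag2 (Kd_gsc / C_dc) (Kd_msc / C_dc)) (diag2 K\<theta>_gsc K\<theta>_msc)
      (diag2 b_g b_msc) (diag2 0 (K\<omega>_r + K\<beta> * K_p)) k_g)"
    (is "asymptotically_stable_origin ?E ?M")
proof -
  define \<kappa> where "\<kappa> = Kd_gsc / K\<theta>_gsc"
  \<comment> \<open>The assumption of equal gain ratios enters here: one \<open>\<kappa>\<close>
    serves both converters.\<close>
  have \<kappa>: "\<kappa> > 0" "Kd_gsc = \<kappa> * K\<theta>_gsc" "Kd_msc = \<kappa> * K\<theta>_msc"
    using assms by (simp_all add: \<kappa>_def, simp add: field_simps)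
  have traj: "trajectory b_g b_msc K\<theta>_gsc K\<theta>_msc \<kappa> C_dc (J_g * \<omega>\<^sub>0) (J_wt * \<omega>_r_del)
      (K\<omega>_r + K\<beta> * K_p) T_g k_g
      (\<lambda>t. fst (x t) $ 1) (\<lambda>t. fst (x t) $ 2) (\<lambda>t. fst (snd (x t)) $ 1) (\<lambda>t. fst (snd (x t)) $ 2)
      (\<lambda>t. fst (snd (snd (x t)))) (\<lambda>t. snd (snd (snd (x t))))"
    if "is_solution ?E ?M x" for x
    using that assms \<kappa>(1) unfolding \<kappa>(2,3) by (intro solution_trajectory) simp_all
  \<comment> \<open>The weights are written out without reference to a solution, since
    \<open>\<delta>\<close> must be chosen before the solution is given.\<close>
  define W where "W = {b_g / K\<theta>_gsc, b_msc / K\<theta>_msc, J_g * \<omega>\<^sub>0 / K\<theta>_gsc, J_wt * \<omega>_r_del / K\<theta>_msc,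
    C_dc, T_g / (k_g * K\<theta>_gsc)}"
  have W: "Min W > 0" "Max W > 0"
    using assms by (simp_all add: W_def less_max_iff_disj)
  have bound: "Min W * (norm (x t))\<^sup>2 \<le> Max W * (norm (x 0))\<^sup>2" if "is_solution ?E ?M x" "t \<ge> 0" for x t
    using trajectory.sum_squares_bound[OF traj[OF that(1)] that(2)]
    unfolding trajectory.W_def[OF traj[OF that(1)]] norm_state_sq W_def .
  have "lyapunov_stable_origin ?E ?M"
    unfolding lyapunov_stable_origin_def
  proof (intro allI impI)
    fix \<epsilon> :: real
    assume \<epsilon>: "\<epsilon> > 0"
    show "\<exists>\<delta>>0. \<forall>x. is_solution ?E ?M x \<longrightarrow> norm (x 0) < \<delta> \<longrightarrow> (\<forall>t\<ge>0. norm (x t) < \<epsilon>)"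
    \<comment> \<open>This radius makes the right-hand side of \<open>bound\<close> smaller than
      \<open>Min W * \<epsilon>\<^sup>2\<close>.\<close>
    proof (intro exI[of _ "\<epsilon> * sqrt (Min W / Max W)"] conjI allI impI)
      show "\<epsilon> * sqrt (Min W / Max W) > 0" using \<epsilon> W by simp
      fix x and t :: real
      assume x: "is_solution ?E ?M x" "norm (x 0) < \<epsilon> * sqrt (Min W / Max W)" "t \<ge> 0"
      have "(norm (x 0))\<^sup>2 < (\<epsilon> * sqrt (Min W / Max W))\<^sup>2"
        using x(2) by (intro power_strict_mono) auto
      also have "\<dots> = \<epsilon>\<^sup>2 * (Min W / Max W)" using W by (simp add: power_mult_distrib)
      finally have "Max W * (norm (x 0))\<^sup>2 < Min W * \<epsilon>\<^sup>2" using W by (simp add: field_simps)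
      with bound[OF x(1,3)] have "Min W * (norm (x t))\<^sup>2 < Min W * \<epsilon>\<^sup>2" by linarith
      then have "(norm (x t))\<^sup>2 < \<epsilon>\<^sup>2" using W by simp
      then show "norm (x t) < \<epsilon>" using \<epsilon> by (auto intro: power_less_imp_less_base)
    qed
  qed
  moreover have "(x \<longlongrightarrow> 0) at_top" if "is_solution ?E ?M x" for x
  proof -
    note lim = trajectory.state_tendsto[OF traj[OF that]]
    have "((\<lambda>t. sqrt ((norm (x t))\<^sup>2)) \<longlongrightarrow> sqrt (0\<^sup>2 + 0\<^sup>2 + 0\<^sup>2 + 0\<^sup>2 + 0\<^sup>2 + 0\<^sup>2)) at_top"
      unfolding norm_state_sq by (intro tendsto_intros lim)
    then show ?thesis by (simp add: tendsto_norm_zero_iff)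
  qed
  ultimately show ?thesis unfolding asymptotically_stable_origin_def by blast
qed

end
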